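(* Let $l,r$ be terms, $L[t]$ a literal, $C$, $D$, $D'$ clauses and $\sigma$ a substitution such that $D = C\sigma \lor D'$ (as multisets of literals, $D$ is the multiset union of $C\sigma$ and $D'$). Then the following two conditions are equivalent: (R1) $L[t] \lor D \succ (l {\,\simeq\,} r)\sigma \lor C\sigma$; (R2) $L[t] \lor D' \succ (l {\,\simeq\,} r)\sigma$.
   Context: Clauses are finite multisets of literals, read as disjunctions; $A \lor B$ for clauses denotes multiset union. $E\sigma$ denotes the result of applying substitution $\sigma$, and $L[t]$ denotes a literal with a particular occurrence of the term $t$. The symbol $\succ$ is a fixed simplification ordering on terms (a well-founded strict partial order stable under substitutions, monotonic, with the subterm property), extended to a strict ordering on literals, and extended to clauses as the multiset extension of the literal ordering. *)

theory Defs
  imports "HOL-Library.Multiset"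
begin

datatype ('f, 'v) trm = Var 'v | Fun 'f "('f, 'v) trm list"

text \<open>
  Equations are ordered pairs: \<open>s \<simeq> t\<close> and \<open>t \<simeq> s\<close> are different atoms.
\<close>

datatype ('p, 'f, 'v) atom =
    Pred 'p "('f, 'v) trm list"
  | Eq "('f, 'v) trm" "('f, 'v) trm"  (infix "\<simeq>" 55)

datatype ('p, 'f, 'v) lit = Pos "('p, 'f, 'v) atom" | Neg "('p, 'f, 'v) atom"

type_synonym ('p, 'f, 'v) clause = "('p, 'f, 'v) lit multiset"

type_synonym ('f, 'v) subst = "'v \<Rightarrow> ('f, 'v) trm"

primrec subst_trm :: "('f, 'v) subst \<Rightarrow> ('f, 'v) trm \<Rightarrow> ('f, 'v) trm" where
  "subst_trm \<sigma> (Var x) = \<sigma> x"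
| "subst_trm \<sigma> (Fun f ts) = Fun f (map (subst_trm \<sigma>) ts)"

primrec subst_atom :: "('f, 'v) subst \<Rightarrow> ('p, 'f, 'v) atom \<Rightarrow> ('p, 'f, 'v) atom" where
  "subst_atom \<sigma> (Pred p ts) = Pred p (map (subst_trm \<sigma>) ts)"
| "subst_atom \<sigma> (s \<simeq> t) = (subst_trm \<sigma> s \<simeq> subst_trm \<sigma> t)"

primrec subst_lit :: "('f, 'v) subst \<Rightarrow> ('p, 'f, 'v) lit \<Rightarrow> ('p, 'f, 'v) lit" where
  "subst_lit \<sigma> (Pos A) = Pos (subst_atom \<sigma> A)"
| "subst_lit \<sigma> (Neg A) = Neg (subst_atom \<sigma> A)"

definition subst_clause :: "('f, 'v) subst \<Rightarrow> ('p, 'f, 'v) clause \<Rightarrow> ('p, 'f, 'v) clause" where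
  "subst_clause \<sigma> C = image_mset (subst_lit \<sigma>) C"

text \<open>
  A particular occurrence of a term is represented by a context, that is, an expression with
  exactly one hole: \<open>L[t]\<close> is \<open>plug_lit L t\<close> for a literal context \<open>L\<close>.
\<close>

datatype ('f, 'v) ctxt =
    Hole
  | More 'f "('f, 'v) trm list" "('f, 'v) ctxt" "('f, 'v) trm list"

datatype ('p, 'f, 'v) atom_ctxt =
    PredC 'p "('f, 'v) trm list" "('f, 'v) ctxt" "('f, 'v) trm list"
  | EqLeft "('f, 'v) ctxt" "('f, 'v) trm"
  | EqRight "('f, 'v) trm" "('f, 'v) ctxt"

datatype ('p, 'f, 'v) lit_ctxt = PosC "('p, 'f, 'v) atom_ctxt" | NegC "('p, 'f, 'v) atom_ctxt"

primrec plug :: "('f, 'v) ctxt \<Rightarrow> ('f, 'v) trm \<Rightarrow> ('f, 'v) trm" where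
  "plug Hole t = t"
| "plug (More f us K vs) t = Fun f (us @ plug K t # vs)"

primrec plug_atom :: "('p, 'f, 'v) atom_ctxt \<Rightarrow> ('f, 'v) trm \<Rightarrow> ('p, 'f, 'v) atom" where
  "plug_atom (PredC p us K vs) t = Pred p (us @ plug K t # vs)"
| "plug_atom (EqLeft K u) t = (plug K t \<simeq> u)"
| "plug_atom (EqRight u K) t = (u \<simeq> plug K t)"

primrec plug_lit :: "('p, 'f, 'v) lit_ctxt \<Rightarrow> ('f, 'v) trm \<Rightarrow> ('p, 'f, 'v) lit" where
  "plug_lit (PosC A) t = Pos (plug_atom A t)"
| "plug_lit (NegC A) t = Neg (plug_atom A t)"

text \<open>Throughout, \<open>gt s t\<close> reads \<open>s \<succ> t\<close>.\<close>

definition strict_order :: "('a \<Rightarrow> 'a \<Rightarrow> bool) \<Rightarrow> bool" where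
  "strict_order gt \<longleftrightarrow> irreflp gt \<and> transp gt"

definition simplification_order :: "(('f, 'v) trm \<Rightarrow> ('f, 'v) trm \<Rightarrow> bool) \<Rightarrow> bool" where
  "simplification_order gt \<longleftrightarrow>
     strict_order gt \<and>
     wfP (\<lambda>s t. gt t s) \<and>
     (\<forall>\<sigma> s t. gt s t \<longrightarrow> gt (subst_trm \<sigma> s) (subst_trm \<sigma> t)) \<and>
     (\<forall>K s t. gt s t \<longrightarrow> gt (plug K s) (plug K t)) \<and>
     (\<forall>K t. K \<noteq> Hole \<longrightarrow> gt (plug K t) t)"

text \<open>
  There are several standard ways to extend a simplification ordering from terms to literals.
  None of them is fixed here: the literal ordering is a separate relation \<open>gt\<close>, about which only
  \<^const>\<open>strict_order\<close> is assumed. Clauses are then compared by its multiset extension.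
  The library's \<^const>\<open>multp\<close> takes a ``less than'' relation, hence the swapped arguments.
\<close>

definition clause_gt ::
  "(('p, 'f, 'v) lit \<Rightarrow> ('p, 'f, 'v) lit \<Rightarrow> bool) \<Rightarrow> ('p, 'f, 'v) clause \<Rightarrow> ('p, 'f, 'v) clause \<Rightarrow> bool"
where
  "clause_gt gt C D \<longleftrightarrow> multp (\<lambda>K L. gt L K) D C"

end

theory Submission imports Defs begin

text \<open>By the hypothesis on \<open>D\<close>, both clauses of the first comparison contain the
  instance of \<open>C\<close>. The multiset extension of a strict order is unchanged when a common
  summand is cancelled (\<open>multp_cancel\<close>), and cancelling this one leaves the second
  comparison.\<close>

theorem theorem3:
  fixes gt_trm :: "('f, 'v) trm \<Rightarrow> ('f, 'v) trm \<Rightarrow> bool"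
    and gt_lit :: "('p, 'f, 'v) lit \<Rightarrow> ('p, 'f, 'v) lit \<Rightarrow> bool"
    and l r t :: "('f, 'v) trm"
    and L :: "('p, 'f, 'v) lit_ctxt"
    and C D D' :: "('p, 'f, 'v) clause"
    and \<sigma> :: "('f, 'v) subst"
  assumes "simplification_order gt_trm"
    and "strict_order gt_lit"
    and "D = subst_clause \<sigma> C + D'"
  shows "clause_gt gt_lit ({#plug_lit L t#} + D) ({#subst_lit \<sigma> (Pos (l \<simeq> r))#} + subst_clause \<sigma> C)
     \<longleftrightarrow> clause_gt gt_lit ({#plug_lit L t#} + D') {#subst_lit \<sigma> (Pos (l \<simeq> r))#}"
proof -
  have "transp (\<lambda>K L. gt_lit L K)" "irreflp (\<lambda>K L. gt_lit L K)"
    using assms(2) unfolding strict_order_def transp_def irreflp_def by blast+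
  then have "multp (\<lambda>K L. gt_lit L K) (X + Z) (Y + Z) \<longleftrightarrow> multp (\<lambda>K L. gt_lit L K) X Y" for X Y Z
    by (auto intro!: multp_cancel intro: irreflp_on_subset)
  \<comment> \<open>\<open>of\<close> follows the order of occurrence \<open>X\<close>,
    \<open>Z\<close>, \<open>Y\<close>: the middle argument is the cancelled summand, and the
    smaller clause comes first as in \<open>multp\<close>.\<close>
  from this[of "{#subst_lit \<sigma> (Pos (l \<simeq> r))#}" "subst_clause \<sigma> C" "{#plug_lit L t#} + D'"]
  show ?thesis
    \<comment> \<open>Only the bracketing and order of the sums still differ.\<close>
    unfolding clause_gt_def assms(3) by (simp only: ac_simps)
qed

end
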